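(* For every integer $m\ge0$ and every $f\in L^2(B_L)$ (with respect to the measure $W_L(z)\,dx\,dy\,dz$), $$S_{2m}f(x,y,z)=\frac{1}{2m+1}\sum_{\nu=0}^{2m}\frac{1}{\pi}\int_{-1}^1\int_0^L\mathcal{R}_{\phi_\nu}(f(\cdot,\cdot,w);t)\,\Phi_\nu(w,t;x,y,z)\,W_L(w)\,dw\,dt,$$ where $$\Phi_\nu(w,t;x,y,z)=\sum_{k=0}^{2m}(k+1)U_k(t)\,U_k(\phi_\nu;x,y)\sum_{l=0}^{2m-k}p_l(w)\,p_l(z),\qquad \phi_\nu=\frac{2\pi\nu}{2m+1}.$$
   Context: $B^2=\{(x,y)\in\mathbb{R}^2: x^2+y^2\le1\}$, $L>0$, $B_L=B^2\times[0,L]$. $W_L$ is a nonnegative function on $[0,L]$ with all moments finite and $\int_0^LW_L(z)\,dz=1$. The inner product on $B_L$ is $\langle f,g\rangle_{B_L}=\frac1\pi\int_{B_L}f\,g\,W_L(z)\,dx\,dy\,dz$. $p_k$ ($k\ge0$) are the orthonormal polynomials of degree $k$ with respect to $W_L$ on $[0,L]$. $U_k$ is the Chebyshev polynomial of the second kind, $U_k(\cos\theta)=\sin((k+1)\theta)/\sin\theta$; $U_k(\theta;x,y):=U_k(x\cos\theta+y\sin\theta)$; $\theta_{j,k}=\frac{j\pi}{k+1}$. Put $P_{l,k,j}(x,y,z)=p_{l-k}(z)U_k(\theta_{j,k};x,y)$ for $0\le j\le k\le l$; these form an orthonormal system with respect to $\langle\cdot,\cdot\rangle_{B_L}$. The Fourier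 coefficients are $\widehat f_{l,k,j}=\langle f,P_{l,k,j}\rangle_{B_L}$ and the partial sum operator is $S_nf=\sum_{l=0}^n\sum_{k=0}^l\sum_{j=0}^k\widehat f_{l,k,j}P_{l,k,j}$. For fixed $w$, $\mathcal{R}_\phi(f(\cdot,\cdot,w);t)$ is the Radon projection of $(x,y)\mapsto f(x,y,w)$, where for a function $g$ on $B^2$, $$\mathcal{R}_\phi(g;t)=\int_{-\sqrt{1-t^2}}^{\sqrt{1-t^2}}g(t\cos\phi-s\sin\phi,\ t\sin\phi+s\cos\phi)\,ds$$ (defined almost everywhere). *)

theory Defs
  imports "HOL-Analysis.Analysis" "HOL-Computational_Algebra.Polynomial"
begin

text \<open>
  All integrals are Lebesgue integrals with respect to the complete measure \<open>lebesgue\<close>, so that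
  \<open>L\<^sup>2\<close> is not restricted to Borel functions and integrands that are defined or measurable
  only almost everywhere are integrated as usual.
\<close>

definition cylinder :: "real \<Rightarrow> (real \<times> real \<times> real) set" where
  "cylinder L = {(x, y, z). x\<^sup>2 + y\<^sup>2 \<le> 1 \<and> 0 \<le> z \<and> z \<le> L}"

text \<open>The case \<open>k = 0\<close> of the moment condition contains the measurability of \<open>W\<close>.\<close>

definition is_weight :: "real \<Rightarrow> (real \<Rightarrow> real) \<Rightarrow> bool" where
  "is_weight L W \<longleftrightarrow>
     (\<forall>z\<in>{0..L}. 0 \<le> W z) \<and>
     (\<forall>k. set_integrable lebesgue {0..L} (\<lambda>z. z ^ k * W z)) \<and>
     (LINT z:{0..L}|lebesgue. W z) = 1"

text \<open>
  Orthonormal polynomials are determined only up to sign, hence a predicate on the whole family.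
\<close>

definition orthonormal_polys :: "real \<Rightarrow> (real \<Rightarrow> real) \<Rightarrow> (nat \<Rightarrow> real poly) \<Rightarrow> bool" where
  "orthonormal_polys L W p \<longleftrightarrow>
     (\<forall>k. degree (p k) = k) \<and>
     (\<forall>i j. (LINT z:{0..L}|lebesgue. poly (p i) z * poly (p j) z * W z) = (if i = j then 1 else 0))"

definition cyl_inner ::
  "real \<Rightarrow> (real \<Rightarrow> real) \<Rightarrow> (real \<times> real \<times> real \<Rightarrow> real) \<Rightarrow> (real \<times> real \<times> real \<Rightarrow> real) \<Rightarrow> real" where
  "cyl_inner L W f g =
     1 / pi * (LINT q:cylinder L|lebesgue. f q * g q * W (snd (snd q)))"

text \<open>Functions, not equivalence classes; values outside the cylinder are irrelevant.\<close>

definition L2_cyl :: "real \<Rightarrow> (real \<Rightarrow> real) \<Rightarrow> (real \<times> real \<times> real \<Rightarrow> real) set" where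
  "L2_cyl L W =
     {f \<in> borel_measurable (lebesgue_on (cylinder L)).
        set_integrable lebesgue (cylinder L) (\<lambda>q. (f q)\<^sup>2 * W (snd (snd q)))}"

definition cheb_U :: "nat \<Rightarrow> real poly" where
  "cheb_U k = (THE u. \<forall>\<theta>. sin \<theta> \<noteq> 0 \<longrightarrow> poly u (cos \<theta>) = sin (real (k + 1) * \<theta>) / sin \<theta>)"

lemma cheb_U_ex1:
  "\<exists>!u :: real poly. \<forall>\<theta>. sin \<theta> \<noteq> 0 \<longrightarrow> poly u (cos \<theta>) = sin (real (k + 1) * \<theta>) / sin \<theta>"
proof (rule ex_ex1I)
  show "\<exists>u :: real poly. \<forall>\<theta>. sin \<theta> \<noteq> 0 \<longrightarrow> poly u (cos \<theta>) = sin (real (k + 1) * \<theta>) / sin \<theta>"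
  proof (induction k rule: less_induct)
    case (less k)
    consider "k = 0" | "k = 1" | n where "k = n + 2"
      by (metis One_nat_def add_2_eq_Suc' not0_implies_Suc)
    then show ?case
    proof cases
      case 1
      then show ?thesis by (intro exI[of _ 1]) auto
    next
      case 2
      then show ?thesis by (intro exI[of _ "[:0, 2:]"]) (auto simp: sin_double)
    next
      case (3 n)
      obtain a :: "real poly"
        where a: "\<And>\<theta>. sin \<theta> \<noteq> 0 \<Longrightarrow> poly a (cos \<theta>) = sin (real (n + 1) * \<theta>) / sin \<theta>"
        using less.IH[of n] 3 by auto
      obtain b :: "real poly"
        where b: "\<And>\<theta>. sin \<theta> \<noteq> 0 \<Longrightarrow> poly b (cos \<theta>) = sin (real (n + 2) * \<theta>) / sin \<theta>"
        using less.IH[of "n + 1"] 3 by auto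
      have rec: "sin (real (n + 3) * \<theta>) = 2 * cos \<theta> * sin (real (n + 2) * \<theta>) - sin (real (n + 1) * \<theta>)"
        for \<theta> :: real
      proof -
        have "sin (real (n + 3) * \<theta>) = sin (real (n + 2) * \<theta> + \<theta>)"
          and "sin (real (n + 1) * \<theta>) = sin (real (n + 2) * \<theta> - \<theta>)"
          by (simp_all add: algebra_simps)
        then show ?thesis by (simp only: sin_add sin_diff) simp
      qed
      show ?thesis
      proof (intro exI[of _ "[:0, 2:] * b - a"] allI impI)
        fix \<theta> :: real
        assume s: "sin \<theta> \<noteq> 0"
        have "k + 1 = n + 3" using 3 by simp
        then show "poly ([:0, 2:] * b - a) (cos \<theta>) = sin (real (k + 1) * \<theta>) / sin \<theta>"
          by (simp only: rec) (simp add: a[OF s] b[OF s] diff_divide_distrib algebra_simps)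
      qed
    qed
  qed
next
  fix u v :: "real poly"
  assume u: "\<forall>\<theta>. sin \<theta> \<noteq> 0 \<longrightarrow> poly u (cos \<theta>) = sin (real (k + 1) * \<theta>) / sin \<theta>"
    and v: "\<forall>\<theta>. sin \<theta> \<noteq> 0 \<longrightarrow> poly v (cos \<theta>) = sin (real (k + 1) * \<theta>) / sin \<theta>"
  have "poly (u - v) t = 0" if "t \<in> {-1<..<1}" for t
  proof -
    have "cos (arccos t) = t" "sin (arccos t) \<noteq> 0"
      using that sin_arccos_nonzero[of t] by auto
    then show ?thesis using u v by (metis diff_self poly_diff)
  qed
  then have "{-1<..<1} \<subseteq> {t. poly (u - v) t = 0}" by auto
  then have "infinite {t. poly (u - v) t = 0}"
    by (meson finite_subset infinite_Ioo less_numeral_extra(1) neg_less_0_iff_less less_trans zero_less_one)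
  then show "u = v" using poly_roots_finite[of "u - v"] by auto
qed

lemma poly_cheb_U_cos:
  "sin \<theta> \<noteq> 0 \<Longrightarrow> poly (cheb_U k) (cos \<theta>) = sin (real (k + 1) * \<theta>) / sin \<theta>"
  using theI'[OF cheb_U_ex1[of k]] unfolding cheb_U_def by blast

definition ridge_U :: "nat \<Rightarrow> real \<Rightarrow> real \<Rightarrow> real \<Rightarrow> real" where
  "ridge_U k \<theta> x y = poly (cheb_U k) (x * cos \<theta> + y * sin \<theta>)"

definition cyl_basis ::
  "(nat \<Rightarrow> real poly) \<Rightarrow> nat \<Rightarrow> nat \<Rightarrow> nat \<Rightarrow> real \<times> real \<times> real \<Rightarrow> real" where
  "cyl_basis p l k j =
     (\<lambda>(x, y, z). poly (p (l - k)) z * ridge_U k (real j * pi / real (k + 1)) x y)"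

definition fourier_coeff ::
  "real \<Rightarrow> (real \<Rightarrow> real) \<Rightarrow> (nat \<Rightarrow> real poly) \<Rightarrow> (real \<times> real \<times> real \<Rightarrow> real) \<Rightarrow> nat \<Rightarrow> nat \<Rightarrow> nat \<Rightarrow> real"
  where
  "fourier_coeff L W p f l k j = cyl_inner L W f (cyl_basis p l k j)"

definition partial_sum ::
  "real \<Rightarrow> (real \<Rightarrow> real) \<Rightarrow> (nat \<Rightarrow> real poly) \<Rightarrow> nat \<Rightarrow> (real \<times> real \<times> real \<Rightarrow> real) \<Rightarrow>
    real \<times> real \<times> real \<Rightarrow> real" where
  "partial_sum L W p n f q =
     (\<Sum>l=0..n. \<Sum>k=0..l. \<Sum>j=0..k. fourier_coeff L W p f l k j * cyl_basis p l k j q)"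

definition radon :: "real \<Rightarrow> (real \<times> real \<Rightarrow> real) \<Rightarrow> real \<Rightarrow> real" where
  "radon \<phi> g t =
     (LINT s:{- sqrt (1 - t\<^sup>2)..sqrt (1 - t\<^sup>2)}|lebesgue.
        g (t * cos \<phi> - s * sin \<phi>, t * sin \<phi> + s * cos \<phi>))"

definition view_angle :: "nat \<Rightarrow> nat \<Rightarrow> real" where
  "view_angle m \<nu> = 2 * pi * real \<nu> / real (2 * m + 1)"

definition Phi ::
  "(nat \<Rightarrow> real poly) \<Rightarrow> nat \<Rightarrow> nat \<Rightarrow> real \<Rightarrow> real \<Rightarrow> real \<Rightarrow> real \<Rightarrow> real \<Rightarrow> real" where
  "Phi p m \<nu> w t x y z =
     (\<Sum>k=0..2*m. real (k + 1) * poly (cheb_U k) t * ridge_U k (view_angle m \<nu>) x y *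
        (\<Sum>l=0..2*m-k. poly (p l) w * poly (p l) z))"

end

theory Submission imports Defs begin

text \<open>
  Both sides are the pairing of \<open>f\<close> with a polynomial kernel. On the left the kernel is
  \<open>\<Sum> P\<^sub>l\<^sub>k\<^sub>j(q) P\<^sub>l\<^sub>k\<^sub>j(x, y, z)\<close>; on the right it is the average over the views of
  \<open>\<Phi>\<^sub>\<nu>(w, u cos \<phi>\<^sub>\<nu> + v sin \<phi>\<^sub>\<nu>; x, y, z)\<close>, by Fubini and a rotation of the disc. The kernels agree
  degree by degree: \<open>\<theta> \<mapsto> U\<^sub>k(\<theta>; u, v) U\<^sub>k(\<theta>; x, y)\<close> is a trigonometric polynomial of degree at most
  \<open>k\<close> in \<open>2\<theta>\<close>, and its means over \<open>j\<pi> / (k + 1)\<close>, \<open>j \<le> k\<close>, and over \<open>2\<pi>\<nu> / (2m + 1)\<close>, \<open>\<nu> \<le> 2m\<close>, both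
  return its constant term, the latter because \<open>2m + 1\<close> is odd.
\<close>

section \<open>Equispaced means of ridge polynomials\<close>

lemma cheb_U_eqI:
  assumes "\<And>\<theta>. sin \<theta> \<noteq> 0 \<Longrightarrow> poly u (cos \<theta>) = sin (real (k + 1) * \<theta>) / sin \<theta>"
  shows "cheb_U k = u"
  unfolding cheb_U_def by (rule the1_equality[OF cheb_U_ex1]) (use assms in blast)

lemma cheb_U_0: "cheb_U 0 = 1"
  by (rule cheb_U_eqI) simp

lemma cheb_U_1: "cheb_U (Suc 0) = [:0, 2:]"
  by (rule cheb_U_eqI) (simp add: sin_double)

lemma cheb_U_rec: "cheb_U (Suc (Suc n)) = [:0, 2:] * cheb_U (Suc n) - cheb_U n"
proof (rule cheb_U_eqI)
  fix \<theta> :: real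
  assume s: "sin \<theta> \<noteq> 0"
  have "sin (real (n + 3) * \<theta>) = sin (real (n + 2) * \<theta> + \<theta>)"
    and "sin (real (n + 1) * \<theta>) = sin (real (n + 2) * \<theta> - \<theta>)"
    by (simp_all add: algebra_simps)
  then have rec: "sin (real (n + 3) * \<theta>) = 2 * cos \<theta> * sin (real (n + 2) * \<theta>) - sin (real (n + 1) * \<theta>)"
    by (simp only: sin_add sin_diff) simp
  have eqs: "Suc (Suc n) + 1 = n + 3" "Suc n + 1 = n + 2" by simp_all
  show "poly ([:0, 2:] * cheb_U (Suc n) - cheb_U n) (cos \<theta>) = sin (real (Suc (Suc n) + 1) * \<theta>) / sin \<theta>"
    unfolding poly_diff poly_mult poly_cheb_U_cos[OF s] eqs rec
    by (simp add: diff_divide_distrib)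
qed

text \<open>By Euler's formulas the linear form is \<open>(x - iy) / 2\<close> times
  \<open>cis \<theta>\<close> plus \<open>(x + iy) / 2\<close> times
  \<open>cis (- \<theta>)\<close>; the factor \<open>cis \<theta>\<close> clears the negative
  frequency.\<close>

lemma linear_form_mult_cis:
  "complex_of_real (x * cos \<theta> + y * sin \<theta>) * cis \<theta> =
     Complex (x / 2) (- y / 2) * cis (2 * \<theta>) + Complex (x / 2) (y / 2)"
proof -
  have c: "cos \<theta> ^ 2 = 1 - sin \<theta> ^ 2"
    by (rule cos_squared_eq)
  have d: "cos (2 * \<theta>) = 2 * (cos \<theta> * cos \<theta>) - 1" "sin (2 * \<theta>) = 2 * (sin \<theta> * cos \<theta>)"
      "sin \<theta> * sin \<theta> = 1 - cos \<theta> * cos \<theta>"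
    by (simp_all add: cos_double c sin_double flip: power2_eq_square)
  show ?thesis
    unfolding complex_eq_iff by (simp add: d, simp add: field_simps d)
qed

text \<open>The polynomial \<open>U\<^sub>k\<close> has degree \<open>k\<close> and the parity of
  \<open>k\<close>, so only the frequencies \<open>-k, -k + 2, ..., k\<close> in
  \<open>\<theta>\<close> occur. The factor \<open>cis (k * \<theta>)\<close> shifts them to
  \<open>0, 2, ..., 2 * k\<close>, which leaves an ordinary polynomial in
  \<open>cis (2 * \<theta>)\<close>. The three-term recurrence carries this through the
  induction.\<close>

lemma ridge_U_cis:
  obtains q :: "complex poly" where "degree q \<le> k"
    and "\<And>\<theta>. complex_of_real (ridge_U k \<theta> x y) * cis (real k * \<theta>) = poly q (cis (2 * \<theta>))"
proof -
  have "\<exists>q :: complex poly. degree q \<le> k \<and>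
    (\<forall>\<theta>. complex_of_real (ridge_U k \<theta> x y) * cis (real k * \<theta>) = poly q (cis (2 * \<theta>)))"
  proof (induction k rule: induct_nat_012)
    case 0
    show ?case by (rule exI[of _ 1]) (simp add: ridge_U_def cheb_U_0)
  next
    case 1
    show ?case
    proof (intro exI[of _ "[:2 * Complex (x / 2) (y / 2), 2 * Complex (x / 2) (- y / 2):]"] conjI allI)
      fix \<theta>
      have "complex_of_real (ridge_U (Suc 0) \<theta> x y) * cis (real (Suc 0) * \<theta>) =
          2 * (complex_of_real (x * cos \<theta> + y * sin \<theta>) * cis \<theta>)"
        by (simp add: ridge_U_def cheb_U_1)
      then show "complex_of_real (ridge_U (Suc 0) \<theta> x y) * cis (real (Suc 0) * \<theta>) =
          poly [:2 * Complex (x / 2) (y / 2), 2 * Complex (x / 2) (- y / 2):] (cis (2 * \<theta>))"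
        unfolding linear_form_mult_cis by (simp add: distrib_left mult_ac)
    qed simp
  next
    case (ge2 n)
    let ?X = "\<lambda>\<theta>. x * cos \<theta> + y * sin \<theta>"
    let ?l = "[:2 * Complex (x / 2) (y / 2), 2 * Complex (x / 2) (- y / 2):]"
    obtain a where a: "degree a \<le> n"
      "\<And>\<theta>. complex_of_real (ridge_U n \<theta> x y) * cis (real n * \<theta>) = poly a (cis (2 * \<theta>))"
      using ge2.IH(1) by blast
    obtain b where b: "degree b \<le> Suc n"
      "\<And>\<theta>. complex_of_real (ridge_U (Suc n) \<theta> x y) * cis (real (Suc n) * \<theta>) = poly b (cis (2 * \<theta>))"
      using ge2.IH(2) by blast
    have "degree (?l * b) \<le> Suc (Suc n)"
      using degree_mult_le[of ?l b] b(1)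
        degree_pCons_le[of "2 * Complex (x / 2) (y / 2)" "[:2 * Complex (x / 2) (- y / 2):]"] by simp
    moreover have "degree ([:0, 1:] * a) \<le> Suc (Suc n)"
      using degree_mult_le[of "[:0, 1:]" a] a(1) by simp
    ultimately have "degree (?l * b - [:0, 1:] * a) \<le> Suc (Suc n)"
      by (rule degree_diff_le)
    moreover have "complex_of_real (ridge_U (Suc (Suc n)) \<theta> x y) * cis (real (Suc (Suc n)) * \<theta>) =
        poly (?l * b - [:0, 1:] * a) (cis (2 * \<theta>))" for \<theta>
    proof -
      have r: "ridge_U (Suc (Suc n)) \<theta> x y = 2 * ?X \<theta> * ridge_U (Suc n) \<theta> x y - ridge_U n \<theta> x y"
        by (simp add: ridge_U_def cheb_U_rec)
      \<comment> \<open>Each term of the recurrence gets its own splitting: one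
        \<open>cis \<theta>\<close> goes to the linear form, while the term two degrees lower is
        left with a surplus \<open>cis (2 * \<theta>)\<close>, hence the factor
        \<open>[:0, 1:]\<close>.\<close>
      have c1: "cis (real (Suc (Suc n)) * \<theta>) = cis \<theta> * cis (real (Suc n) * \<theta>)"
        and c2: "cis (real (Suc (Suc n)) * \<theta>) = cis (2 * \<theta>) * cis (real n * \<theta>)"
        by (simp_all add: cis_mult algebra_simps)
      have "complex_of_real (ridge_U (Suc (Suc n)) \<theta> x y) * cis (real (Suc (Suc n)) * \<theta>) =
          2 * complex_of_real (?X \<theta>) * complex_of_real (ridge_U (Suc n) \<theta> x y) * cis (real (Suc (Suc n)) * \<theta>)
          - complex_of_real (ridge_U n \<theta> x y) * cis (real (Suc (Suc n)) * \<theta>)"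
        unfolding r by (simp add: left_diff_distrib)
      also have "\<dots> = 2 * (complex_of_real (?X \<theta>) * cis \<theta>) *
            (complex_of_real (ridge_U (Suc n) \<theta> x y) * cis (real (Suc n) * \<theta>))
          - cis (2 * \<theta>) * (complex_of_real (ridge_U n \<theta> x y) * cis (real n * \<theta>))"
        by (subst c1, subst c2) (simp only: mult_ac)
      also have "\<dots> = poly (?l * b - [:0, 1:] * a) (cis (2 * \<theta>))"
        unfolding linear_form_mult_cis a(2) b(2) by (simp add: algebra_simps)
      finally show ?thesis .
    qed
    ultimately show ?case by blast
  qed
  then show ?thesis using that by blast
qed

section \<open>Exponential sums over equispaced angles\<close>

lemma cis_eq_1_iff_dvd:
  fixes N :: nat and d :: int
  assumes "N > 0"
  shows "cis (2 * pi * of_int d / real N) = 1 \<longleftrightarrow> int N dvd d"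
proof -
  have "cis (2 * pi * of_int d / real N) = 1 \<longleftrightarrow> cos (2 * pi * of_int d / real N) = 1"
    using cos_one_sin_zero by (auto simp: complex_eq_iff)
  also have "\<dots> \<longleftrightarrow> (\<exists>n::int. of_int d = real_of_int (int N * n))"
    unfolding cos_one_2pi_int using assms
    by (intro iff_exI) (simp add: field_simps)
  also have "\<dots> \<longleftrightarrow> int N dvd d"
    unfolding of_int_eq_iff dvd_def ..
  finally show ?thesis .
qed

text \<open>A geometric sum over powers of an \<open>N\<close>-th root of unity vanishes unless the
  root is 1. Coprimality cancels \<open>r\<close> in the divisibility condition;
  \<open>r = 1\<close> and \<open>r = 2\<close> give the two families of angles to be
  compared.\<close>

lemma sum_cis_equispaced:
  fixes N r :: nat and d :: int
  assumes "N > 0" "coprime r N"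
  shows "(\<Sum>j<N. cis (2 * pi * of_int (int r * d) / real N) ^ j) = (if int N dvd d then of_nat N else 0)"
proof -
  let ?w = "cis (2 * pi * of_int (int r * d) / real N)"
  have iff: "?w = 1 \<longleftrightarrow> int N dvd d"
    unfolding cis_eq_1_iff_dvd[OF assms(1)] using assms(2)
    by (simp add: coprime_dvd_mult_right_iff coprime_commute)
  have "real N * (2 * pi * of_int (int r * d) / real N) = 2 * pi * of_int (int r * d)"
    using assms(1) by simp
  then have "?w ^ N = cis (2 * pi * of_int (int r * d))"
    by (simp only: Complex.DeMoivre)
  also have "\<dots> = 1" by (rule cis_multiple_2pi) simp
  finally have "(\<Sum>j<N. ?w ^ j) = 0" if "?w \<noteq> 1"
    using geometric_sum[OF that, of N] by simp
  then show ?thesis using iff by auto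
qed

text \<open>
  The hypothesis on \<open>F\<close> says that \<open>F \<theta>\<close> is the sum of \<open>coeff Q i * cis (2 * (i - k) * \<theta>)\<close> over \<open>i \<le> 2 * k\<close>,
  so \<open>coeff Q k\<close> is its mean value.
\<close>

lemma sum_even_trig_poly_equispaced:
  fixes N r k :: nat and Q :: "complex poly"
  assumes Q: "degree Q \<le> 2 * k" "\<And>\<theta>. complex_of_real (F \<theta>) * cis (real (2 * k) * \<theta>) = poly Q (cis (2 * \<theta>))"
    and N: "k < N" "coprime r N"
  shows "complex_of_real (\<Sum>j<N. F (real j * (pi * real r / real N))) = of_nat N * coeff Q k"
proof -
  let ?b = "2 * pi * real r / real N"
  let ?w = "\<lambda>i. cis (2 * pi * of_int (int r * (int i - int k)) / real N)"
  have F: "complex_of_real (F (real j * (pi * real r / real N))) = (\<Sum>i\<le>2 * k. coeff Q i * ?w i ^ j)" for j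
  proof -
    let ?t = "real j * (pi * real r / real N)"
    have "complex_of_real (F ?t) = poly Q (cis (2 * ?t)) * cis (- (real (2 * k) * ?t))"
      unfolding Q(2)[symmetric] by (simp only: mult.assoc cis_mult) simp
    also have "poly Q (cis (2 * ?t)) = (\<Sum>i\<le>2 * k. coeff Q i * cis (2 * ?t) ^ i)"
      unfolding poly_altdef using Q(1)
      by (intro sum.mono_neutral_left) (auto simp: coeff_eq_0)
    also have "\<dots> * cis (- (real (2 * k) * ?t)) = (\<Sum>i\<le>2 * k. coeff Q i * ?w i ^ j)"
      unfolding sum_distrib_right
    proof (rule sum.cong[OF refl])
      fix i
      have "real i * (2 * ?t) + - (real (2 * k) * ?t) =
          real j * (2 * pi * of_int (int r * (int i - int k)) / real N)"
        using N(1) by (simp add: field_simps)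
      then show "coeff Q i * cis (2 * ?t) ^ i * cis (- (real (2 * k) * ?t)) = coeff Q i * ?w i ^ j"
        unfolding Complex.DeMoivre mult.assoc cis_mult by (simp only:)
    qed
    finally show ?thesis .
  qed
  have z: "(\<Sum>j<N. ?w i ^ j) = (if i = k then of_nat N else 0)" if "i \<le> 2 * k" for i
  proof -
    \<comment> \<open>From \<open>i \<le> 2 * k\<close> and \<open>k < N\<close> the difference is
      less than \<open>N\<close> in absolute value, so no other frequency is aliased onto the
      constant term.\<close>
    have "int N dvd int i - int k \<longleftrightarrow> i = k"
      using that N(1) zdvd_imp_le[of "int N" "\<bar>int i - int k\<bar>"] by (cases "i = k") auto
    then show ?thesis
      using sum_cis_equispaced[of N r "int i - int k"] N by simp
  qed
  have "complex_of_real (\<Sum>j<N. F (real j * (pi * real r / real N))) =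
      (\<Sum>i\<le>2 * k. coeff Q i * (\<Sum>j<N. ?w i ^ j))"
    unfolding of_real_sum F by (subst sum.swap) (simp add: sum_distrib_left)
  also have "\<dots> = (\<Sum>i\<le>2 * k. if i = k then coeff Q i * of_nat N else 0)"
    by (intro sum.cong refl) (subst z, auto)
  also have "\<dots> = of_nat N * coeff Q k"
    by (simp add: sum.delta)
  finally show ?thesis .
qed

lemma ridge_U_quadrature:
  assumes "k \<le> 2 * m"
  shows "(\<Sum>j=0..k. ridge_U k (real j * pi / real (k + 1)) u v * ridge_U k (real j * pi / real (k + 1)) x y) =
    real (k + 1) / real (2 * m + 1) *
      (\<Sum>\<nu>=0..2*m. ridge_U k (view_angle m \<nu>) u v * ridge_U k (view_angle m \<nu>) x y)"
proof -
  define F where "F = (\<lambda>\<theta>. ridge_U k \<theta> u v * ridge_U k \<theta> x y)"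
  obtain a where a: "degree a \<le> k"
    "\<And>\<theta>. complex_of_real (ridge_U k \<theta> u v) * cis (real k * \<theta>) = poly a (cis (2 * \<theta>))"
    using ridge_U_cis by blast
  obtain b where b: "degree b \<le> k"
    "\<And>\<theta>. complex_of_real (ridge_U k \<theta> x y) * cis (real k * \<theta>) = poly b (cis (2 * \<theta>))"
    using ridge_U_cis by blast
  have deg: "degree (a * b) \<le> 2 * k"
    using degree_mult_le[of a b] a(1) b(1) by linarith
  have ab: "complex_of_real (F \<theta>) * cis (real (2 * k) * \<theta>) = poly (a * b) (cis (2 * \<theta>))" for \<theta>
  proof -
    have "cis (real (2 * k) * \<theta>) = cis (real k * \<theta>) * cis (real k * \<theta>)"
      by (simp add: cis_mult algebra_simps)
    then show ?thesis
      unfolding F_def poly_mult a(2)[symmetric] b(2)[symmetric] of_real_mult by (simp only: mult_ac)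
  qed
  have 1: "complex_of_real (\<Sum>j<k+1. F (real j * pi / real (k + 1))) = of_nat (k + 1) * coeff (a * b) k"
    using sum_even_trig_poly_equispaced[OF deg ab, of "k + 1" 1] by simp
  \<comment> \<open>The views are the case \<open>N = 2 * m + 1\<close>, \<open>r = 2\<close>: the
    bound \<open>k \<le> 2 * m\<close> gives \<open>k < N\<close>, and 2 is coprime to the odd
    number \<open>N\<close>.\<close>
  have "real j * (pi * real 2 / real (2 * m + 1)) = view_angle m j" for j
    by (simp add: view_angle_def)
  then have 2: "complex_of_real (\<Sum>\<nu><2*m+1. F (view_angle m \<nu>)) = of_nat (2 * m + 1) * coeff (a * b) k"
    using sum_even_trig_poly_equispaced[OF deg ab, of "2 * m + 1" 2] assms by simp
  have "complex_of_real (\<Sum>j<k+1. F (real j * pi / real (k + 1))) =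
      complex_of_real (real (k + 1) / real (2 * m + 1) * (\<Sum>\<nu><2*m+1. F (view_angle m \<nu>)))"
    unfolding of_real_mult 1 2 by (simp add: field_simps del: of_nat_Suc)
  then show ?thesis
    unfolding of_real_eq_iff F_def by (simp add: atLeast0AtMost lessThan_Suc_atMost)
qed

text \<open>Indexed by the ridge degree \<open>k\<close> and the axial degree \<open>l - k\<close>,
  the triangle of indices takes the shape of the sums in \<open>Phi\<close>. The sum over
  \<open>j\<close> then depends on \<open>k\<close> alone and is exchanged for a mean over the
  views.\<close>

lemma partial_sum_kernel_eq:
  "(\<Sum>l=0..2*m. \<Sum>k=0..l. \<Sum>j=0..k. cyl_basis p l k j (u, v, w) * cyl_basis p l k j (x, y, z)) =
    1 / real (2 * m + 1) *
      (\<Sum>\<nu>=0..2*m. Phi p m \<nu> w (u * cos (view_angle m \<nu>) + v * sin (view_angle m \<nu>)) x y z)"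
proof -
  define n where "n = 2 * m"
  define D where "D = (\<lambda>k. \<Sum>j=0..k. ridge_U k (real j * pi / real (k + 1)) u v *
    ridge_U k (real j * pi / real (k + 1)) x y)"
  define B where "B = (\<lambda>l. poly (p l) w * poly (p l) z)"
  have "(\<Sum>l=0..n. \<Sum>k=0..l. \<Sum>j=0..k. cyl_basis p l k j (u, v, w) * cyl_basis p l k j (x, y, z)) =
      (\<Sum>l=0..n. \<Sum>k=0..l. B (l - k) * D k)"
    by (simp add: cyl_basis_def B_def D_def sum_distrib_left mult_ac)
  also have "\<dots> = (\<Sum>(l, k)\<in>(SIGMA l:{0..n}. {0..l}). B (l - k) * D k)"
    by (simp add: sum.Sigma)
  also have "\<dots> = (\<Sum>(k, l)\<in>(SIGMA k:{0..n}. {0..n-k}). B l * D k)"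
    by (rule sum.reindex_bij_witness[where i = "\<lambda>(k, l). (k + l, k)" and j = "\<lambda>(l, k). (k, l - k)"]) auto
  also have "\<dots> = (\<Sum>k=0..n. D k * (\<Sum>l=0..n-k. B l))"
    by (simp add: sum.Sigma[symmetric] sum_distrib_left mult_ac)
  also have "\<dots> = (\<Sum>k=0..n. \<Sum>\<nu>=0..n. 1 / real (n + 1) * (real (k + 1) *
      ridge_U k (view_angle m \<nu>) u v * ridge_U k (view_angle m \<nu>) x y * (\<Sum>l=0..n-k. B l)))"
  proof (rule sum.cong[OF refl])
    fix k assume "k \<in> {0..n}"
    then have k: "k \<le> 2 * m" by (simp add: n_def)
    obtain S where S: "(\<Sum>l=0..n-k. B l) = S" by blast
    show "D k * (\<Sum>l=0..n-k. B l) = (\<Sum>\<nu>=0..n. 1 / real (n + 1) * (real (k + 1) *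
      ridge_U k (view_angle m \<nu>) u v * ridge_U k (view_angle m \<nu>) x y * (\<Sum>l=0..n-k. B l)))"
      unfolding D_def ridge_U_quadrature[OF k, folded n_def] S
      by (simp add: sum_distrib_left sum_distrib_right sum_divide_distrib mult_ac)
  qed
  also have "\<dots> = 1 / real (n + 1) *
      (\<Sum>\<nu>=0..n. Phi p m \<nu> w (u * cos (view_angle m \<nu>) + v * sin (view_angle m \<nu>)) x y z)"
    by (subst sum.swap) (simp add: sum_distrib_left Phi_def n_def B_def ridge_U_def)
  finally show ?thesis unfolding n_def .
qed

section \<open>Lebesgue integrals on product spaces\<close>

text \<open>Preimages under \<open>f\<close> and \<open>g\<close> differ by a subset of a null set,
  which the completion makes measurable.\<close>

lemma borel_measurable_completion_AE_eq:
  fixes f g :: "'a \<Rightarrow> 'b::topological_space"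
  assumes g: "g \<in> borel_measurable M" and eq: "AE x in M. f x = g x"
  shows "f \<in> borel_measurable (completion M)"
proof (rule measurableI)
  fix A :: "'b set" assume "A \<in> sets borel"
  then have 1: "g -` A \<inter> space M \<in> sets (completion M)"
    using measurable_sets[OF g] by simp
  have 2: "AE x in completion M. x \<in> g -` A \<inter> space M \<longleftrightarrow> x \<in> f -` A \<inter> space (completion M)"
    using AE_completion[OF eq] by eventually_elim simp
  show "f -` A \<inter> space (completion M) \<in> sets (completion M)"
    by (rule completion.in_sets_AE[OF 2 1]) simp
qed simp

text \<open>The bridge from \<open>lebesgue\<close> to \<open>lborel\<close>: a Lebesgue measurable
  function is replaced by a Borel version \<open>g\<close>, to which the theorems on Borel product
  measures apply.\<close>

lemma
  fixes f g :: "'a \<Rightarrow> 'b::{banach, second_countable_topology}"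
  assumes g: "g \<in> borel_measurable M" and eq: "AE x in M. f x = g x"
  shows integrable_completion_AE_eq: "integrable (completion M) f \<longleftrightarrow> integrable M g"
    and integral_completion_AE_eq: "integral\<^sup>L (completion M) f = integral\<^sup>L M g"
proof -
  have *: "f \<in> borel_measurable (completion M)" "g \<in> borel_measurable (completion M)"
      "AE x in completion M. f x = g x"
    using borel_measurable_completion_AE_eq[OF assms] measurable_completion[OF g] AE_completion[OF eq]
    by auto
  show "integrable (completion M) f \<longleftrightarrow> integrable M g"
    using integrable_cong_AE[OF *] integrable_completion[OF g] by simp
  show "integral\<^sup>L (completion M) f = integral\<^sup>L M g"
    using integral_cong_AE[OF *] integral_completion[OF g] by simp
qed

section \<open>Fubini and change of variables for the completed measure\<close>

lemma AE_lborel_pair: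
  fixes P :: "'a::euclidean_space \<times> 'b::euclidean_space \<Rightarrow> bool"
  assumes "AE q in lborel. P q"
  shows "AE x in lborel. AE y in lborel. P (x, y)"
  by (rule lborel_pair.AE_pair, unfold lborel_prod, rule assms)

text \<open>On a product space \<open>lebesgue\<close> is the completion of a product measure, not
  the product of the completed factors, so Fubini is applied to a Borel version \<open>g\<close>.
  Almost every slice of \<open>f\<close> agrees almost everywhere with that of \<open>g\<close>;
  exceptional slices of \<open>f\<close> may fail to be measurable.\<close>

lemma lebesgue_Fubini:
  fixes f :: "'a::euclidean_space \<times> 'b::euclidean_space \<Rightarrow> real"
  assumes "integrable lebesgue f"
  shows AE_integrable_lebesgue_fst: "AE x in lborel. integrable lebesgue (\<lambda>y. f (x, y))"
    and integrable_lebesgue_fst: "integrable lebesgue (\<lambda>x. LINT y|lebesgue. f (x, y))"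
    and integral_lebesgue_fst: "(LINT x|lebesgue. LINT y|lebesgue. f (x, y)) = integral\<^sup>L lebesgue f"
proof -
  obtain g where g: "g \<in> borel_measurable lborel" "AE q in lborel. f q = g q"
    using completion_ex_borel_measurable_real[OF borel_measurable_integrable[OF assms]] by blast
  have gi: "integrable (lborel \<Otimes>\<^sub>M lborel) g"
    using assms integrable_completion_AE_eq[OF g] by (simp add: lborel_prod)
  have gm: "(\<lambda>y. g (x, y)) \<in> borel_measurable lborel" for x
    using g(1) by measurable
  have ae: "AE x in lborel. AE y in lborel. f (x, y) = g (x, y)"
    by (rule AE_lborel_pair[OF g(2)])
  show "AE x in lborel. integrable lebesgue (\<lambda>y. f (x, y))"
    using ae lborel_pair.AE_integrable_fst'[OF gi]
    by eventually_elim (rule iffD2[OF integrable_completion_AE_eq[OF gm]])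
  have ae_fst: "AE x in lborel. (LINT y|lebesgue. f (x, y)) = (LINT y|lborel. g (x, y))"
    using ae by eventually_elim (rule integral_completion_AE_eq[OF gm])
  have gi_fst: "integrable lborel (\<lambda>x. LINT y|lborel. g (x, y))"
    by (rule lborel_pair.integrable_fst'[OF gi])
  note gm_fst = borel_measurable_integrable[OF gi_fst]
  show "integrable lebesgue (\<lambda>x. LINT y|lebesgue. f (x, y))"
    unfolding integrable_completion_AE_eq[OF gm_fst ae_fst] by (rule gi_fst)
  have "(LINT x|lebesgue. LINT y|lebesgue. f (x, y)) = (LINT x|lborel. LINT y|lborel. g (x, y))"
    by (rule integral_completion_AE_eq[OF gm_fst ae_fst])
  also have "\<dots> = integral\<^sup>L lborel g"
    using lborel_pair.integral_fst'[OF gi] by (simp add: lborel_prod)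
  also have "\<dots> = integral\<^sup>L lebesgue f"
    by (rule integral_completion_AE_eq[OF g, symmetric])
  finally show "(LINT x|lebesgue. LINT y|lebesgue. f (x, y)) = integral\<^sup>L lebesgue f" .
qed

text \<open>Preimages of null sets under \<open>T\<close> are null, so \<open>f\<close> after
  \<open>T\<close> agrees almost everywhere with \<open>g\<close> after \<open>T\<close> for a Borel
  version \<open>g\<close> of \<open>f\<close>.\<close>

lemma lebesgue_measure_preserving:
  fixes f :: "'a::euclidean_space \<Rightarrow> real" and T :: "'a \<Rightarrow> 'a"
  assumes T: "T \<in> lborel \<rightarrow>\<^sub>M lborel" "distr lborel lborel T = lborel"
    and f: "integrable lebesgue f"
  shows integrable_lebesgue_measure_preserving: "integrable lebesgue (\<lambda>x. f (T x))"
    and integral_lebesgue_measure_preserving: "(LINT x|lebesgue. f (T x)) = integral\<^sup>L lebesgue f"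
proof -
  obtain g where g: "g \<in> borel_measurable lborel" "AE q in lborel. f q = g q"
    using completion_ex_borel_measurable_real[OF borel_measurable_integrable[OF f]] by blast
  have gi: "integrable lborel g"
    using f integrable_completion_AE_eq[OF g] by simp
  have m: "(\<lambda>x. g (T x)) \<in> borel_measurable lborel"
    using measurable_compose[OF T(1) g(1)] .
  have ae: "AE x in lborel. f (T x) = g (T x)"
    by (rule AE_distrD[OF T(1)]) (unfold T(2), rule g(2))
  show "integrable lebesgue (\<lambda>x. f (T x))"
    unfolding integrable_completion_AE_eq[OF m ae]
    using integrable_distr_eq[OF T(1) g(1)] gi by (simp add: T(2))
  show "(LINT x|lebesgue. f (T x)) = integral\<^sup>L lebesgue f"
    unfolding integral_completion_AE_eq[OF m ae] integral_completion_AE_eq[OF g]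
    using integral_distr[OF T(1) g(1)] by (simp add: T(2))
qed

text \<open>Indicator functions test the measure of every Borel set. In this form Tonelli's theorem
  applies directly to shears.\<close>

lemma distr_lborelI:
  fixes T :: "'a::euclidean_space \<Rightarrow> 'a"
  assumes [measurable]: "T \<in> lborel \<rightarrow>\<^sub>M lborel"
    and "\<And>g. g \<in> borel_measurable lborel \<Longrightarrow> (\<integral>\<^sup>+ x. g (T x) \<partial>lborel) = (\<integral>\<^sup>+ x. g x \<partial>lborel)"
  shows "distr lborel lborel T = lborel"
proof (rule measure_eqI)
  fix A :: "'a set" assume "A \<in> sets (distr lborel lborel T)"
  then have A[measurable]: "A \<in> sets lborel" by (simp only: sets_distr)
  have "emeasure (distr lborel lborel T) A = (\<integral>\<^sup>+ x. indicator A x \<partial>distr lborel lborel T)"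
    by (rule nn_integral_indicator[symmetric]) (use A in simp)
  also have "\<dots> = (\<integral>\<^sup>+ x. indicator A (T x) \<partial>lborel)"
    by (rule nn_integral_distr) (use A assms(1) in auto)
  also have "\<dots> = (\<integral>\<^sup>+ x. indicator A x \<partial>lborel)"
    by (rule assms(2)) simp
  also have "\<dots> = emeasure lborel A"
    by (rule nn_integral_indicator[OF A])
  finally show "emeasure (distr lborel lborel T) A = emeasure lborel A" .
qed simp

section \<open>Translations, shears and slicewise maps preserving Lebesgue measure\<close>

lemma nn_integral_lborel_translate:
  fixes g :: "'a::euclidean_space \<Rightarrow> ennreal"
  assumes "g \<in> borel_measurable lborel"
  shows "(\<integral>\<^sup>+ x. g (x + c) \<partial>lborel) = (\<integral>\<^sup>+ x. g x \<partial>lborel)"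
  using nn_integral_distr[of "(+) c" lborel borel g] assms
  by (simp add: lborel_distr_plus add.commute)

text \<open>By Tonelli with \<open>x\<close> integrated first: for fixed \<open>y\<close> the map is
  a translation in \<open>x\<close>.\<close>

lemma distr_lborel_shear_fst:
  fixes S :: "'b::euclidean_space \<Rightarrow> 'a::euclidean_space"
  assumes [measurable]: "S \<in> borel_measurable borel"
  shows "distr lborel lborel (\<lambda>(x, y). (x + S y, y)) = lborel"
proof (rule distr_lborelI)
  show "(\<lambda>(x, y). (x + S y, y)) \<in> lborel \<rightarrow>\<^sub>M lborel"
    by (simp add: lborel_prod[symmetric] split_beta')
  fix g :: "'a \<times> 'b \<Rightarrow> ennreal" assume "g \<in> borel_measurable lborel"
  then have g[measurable]: "g \<in> borel_measurable (lborel \<Otimes>\<^sub>M lborel)" by (simp add: lborel_prod)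
  have "(\<integral>\<^sup>+ q. g (case q of (x, y) \<Rightarrow> (x + S y, y)) \<partial>lborel) =
      (\<integral>\<^sup>+ y. \<integral>\<^sup>+ x. g (x + S y, y) \<partial>lborel \<partial>lborel)"
    unfolding lborel_prod[symmetric] by (subst lborel_pair.nn_integral_snd[symmetric]) auto
  also have "\<dots> = (\<integral>\<^sup>+ y. \<integral>\<^sup>+ x. g (x, y) \<partial>lborel \<partial>lborel)"
    by (intro nn_integral_cong nn_integral_lborel_translate) simp
  also have "\<dots> = (\<integral>\<^sup>+ q. g q \<partial>lborel)"
    unfolding lborel_prod[symmetric] by (rule lborel_pair.nn_integral_snd) simp
  finally show "(\<integral>\<^sup>+ q. g (case q of (x, y) \<Rightarrow> (x + S y, y)) \<partial>lborel) = (\<integral>\<^sup>+ q. g q \<partial>lborel)" .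
qed

text \<open>Tonelli slice by slice. It serves both for a shear along the second factor and for the
  exchange of the last two of three coordinates.\<close>

lemma distr_lborel_apsnd:
  fixes S :: "'a::euclidean_space \<Rightarrow> 'b::euclidean_space \<Rightarrow> 'b"
  assumes [measurable]: "(\<lambda>(x, y). S x y) \<in> borel \<Otimes>\<^sub>M borel \<rightarrow>\<^sub>M borel"
    and S: "\<And>x. distr lborel lborel (S x) = lborel"
  shows "distr lborel lborel (\<lambda>(x, y). (x, S x y)) = lborel"
proof (rule distr_lborelI)
  show "(\<lambda>(x, y). (x, S x y)) \<in> lborel \<rightarrow>\<^sub>M lborel"
    by (simp add: lborel_prod[symmetric] split_beta')
  fix g :: "'a \<times> 'b \<Rightarrow> ennreal" assume "g \<in> borel_measurable lborel"
  then have g[measurable]: "g \<in> borel_measurable (lborel \<Otimes>\<^sub>M lborel)" by (simp add: lborel_prod)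
  have [measurable]: "S x \<in> lborel \<rightarrow>\<^sub>M lborel" for x
    by simp
  have "(\<integral>\<^sup>+ q. g (case q of (x, y) \<Rightarrow> (x, S x y)) \<partial>lborel) =
      (\<integral>\<^sup>+ x. \<integral>\<^sup>+ y. g (x, S x y) \<partial>lborel \<partial>lborel)"
    unfolding lborel_prod[symmetric] by (subst lborel.nn_integral_fst[symmetric]) auto
  also have "\<dots> = (\<integral>\<^sup>+ x. \<integral>\<^sup>+ y. g (x, y) \<partial>distr lborel lborel (S x) \<partial>lborel)"
    by (intro nn_integral_cong) (subst nn_integral_distr, auto)
  also have "\<dots> = (\<integral>\<^sup>+ q. g q \<partial>lborel)"
    unfolding S lborel_prod[symmetric] by (rule lborel.nn_integral_fst) simp
  finally show "(\<integral>\<^sup>+ q. g (case q of (x, y) \<Rightarrow> (x, S x y)) \<partial>lborel) = (\<integral>\<^sup>+ q. g q \<partial>lborel)" .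
qed

lemma distr_lborel_swap:
  "distr lborel lborel (\<lambda>(x, y). (y, x)) = (lborel :: ('a::euclidean_space \<times> 'a) measure)"
  by (rule lborel_pair.distr_pair_swap[unfolded lborel_prod, symmetric])

lemma distr_lborel_translate:
  "distr lborel lborel (\<lambda>x. x + c) = (lborel :: 'a::euclidean_space measure)"
  by (rule distr_lborelI) (auto intro!: nn_integral_lborel_translate)

lemma distr_lborel_comp:
  assumes "S \<in> lborel \<rightarrow>\<^sub>M lborel" "distr lborel lborel S = lborel"
    and "T \<in> lborel \<rightarrow>\<^sub>M lborel" "distr lborel lborel T = lborel"
  shows "distr lborel lborel (\<lambda>x. T (S x)) = lborel"
  using distr_distr[OF assms(3,1)] assms by (simp add: o_def)

text \<open>Measurability of \<open>g\<close> follows from that of \<open>f\<close> by completeness.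
  This suits iterated integrals, whose inner integral is controlled only almost everywhere.\<close>

lemma integral_lebesgue_cong_AE:
  fixes f g :: "'a::euclidean_space \<Rightarrow> real"
  assumes f: "f \<in> borel_measurable lebesgue" and eq: "AE x in lborel. g x = f x"
  shows "integral\<^sup>L lebesgue g = integral\<^sup>L lebesgue f"
proof -
  obtain h where h: "h \<in> borel_measurable lborel" "AE x in lborel. f x = h x"
    using completion_ex_borel_measurable_real[OF f] by blast
  have "AE x in lborel. g x = h x"
    using eq h(2) by eventually_elim simp
  then show ?thesis
    using integral_completion_AE_eq[OF h(1)] h(2) by metis
qed

text \<open>For almost every \<open>x\<close> the slice in the other two variables is integrable and
  Fubini applies to it; the remaining \<open>x\<close> do not affect the outer integral.\<close>

lemma integral_lebesgue_iterated3:
  fixes f :: "'a::euclidean_space \<times> 'b::euclidean_space \<times> 'c::euclidean_space \<Rightarrow> real"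
  assumes "integrable lebesgue f"
  shows "(LINT x|lebesgue. LINT y|lebesgue. LINT z|lebesgue. f (x, y, z)) = integral\<^sup>L lebesgue f"
proof -
  have "(LINT x|lebesgue. LINT y|lebesgue. LINT z|lebesgue. f (x, y, z)) =
      (LINT x|lebesgue. LINT q|lebesgue. f (x, q))"
  proof (rule integral_lebesgue_cong_AE)
    show "(\<lambda>x. LINT q|lebesgue. f (x, q)) \<in> borel_measurable lebesgue"
      using integrable_lebesgue_fst[OF assms] by (rule borel_measurable_integrable)
    show "AE x in lborel. (LINT y|lebesgue. LINT z|lebesgue. f (x, y, z)) = (LINT q|lebesgue. f (x, q))"
      using AE_integrable_lebesgue_fst[OF assms] by eventually_elim (rule integral_lebesgue_fst)
  qed
  then show ?thesis using integral_lebesgue_fst[OF assms] by simp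
qed

lemma integrable_lborel_product:
  fixes a :: "'a::euclidean_space \<Rightarrow> real" and b :: "'b::euclidean_space \<Rightarrow> real"
  assumes a: "integrable lborel a" and b: "integrable lborel b"
  shows "integrable lborel (\<lambda>(x, y). a x * b y)"
proof -
  note [measurable] = borel_measurable_integrable[OF a] borel_measurable_integrable[OF b]
  have "integrable (lborel \<Otimes>\<^sub>M lborel) (\<lambda>(x, y). a x * b y)"
    by (rule lborel_pair.Fubini_integrable) (use a b in \<open>auto simp: abs_mult\<close>)
  then show ?thesis by (simp add: lborel_prod)
qed

lemma AE_lborel_sndI:
  fixes P :: "'b::euclidean_space \<Rightarrow> bool"
  assumes "AE y in lborel. P y"
  shows "AE q in (lborel :: ('a::euclidean_space \<times> 'b) measure). P (snd q)"
proof -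
  obtain N where N: "{y. \<not> P y} \<subseteq> N" "N \<in> null_sets lborel"
    using assms by (auto simp: eventually_ae_filter)
  have "UNIV \<times> N \<in> null_sets (lborel \<Otimes>\<^sub>M lborel :: ('a \<times> 'b) measure)"
    using N(2) by (intro lborel.times_in_null_sets2) auto
  then have "UNIV \<times> N \<in> null_sets (lborel :: ('a \<times> 'b) measure)"
    unfolding lborel_prod .
  then show ?thesis
    by (rule AE_I') (use N(1) in auto)
qed

section \<open>Radon coordinates\<close>

text \<open>The coordinates are ordered as \<open>(t, w, s)\<close>, the order of the iterated integral in the theorem.\<close>

definition rot :: "real \<Rightarrow> real \<times> real \<times> real \<Rightarrow> real \<times> real \<times> real" where
  "rot \<phi> = (\<lambda>(t, w, s). (t * cos \<phi> - s * sin \<phi>, w, t * sin \<phi> + s * cos \<phi>))"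

lemma rot_measurable [measurable]: "rot \<phi> \<in> borel \<rightarrow>\<^sub>M borel"
  unfolding rot_def split_beta' by (intro borel_measurable_continuous_onI continuous_intros)

lemma rot_add: "rot (\<phi> + \<psi>) q = rot \<phi> (rot \<psi> q)"
  by (cases q) (simp add: rot_def cos_add sin_add, simp add: algebra_simps)

text \<open>
  A rotation is a product of three shears unless \<open>cos (\<phi> / 2) = 0\<close>; in that case it is the square of the
  rotation by \<open>\<phi> / 2\<close>, to which this applies.
\<close>

lemma distr_lborel_rot: "distr lborel lborel (rot \<phi>) = lborel"
proof -
  have shears: "distr lborel lborel (rot \<phi>) = lborel" if c: "cos (\<phi> / 2) \<noteq> 0" for \<phi>
  proof -
    \<comment> \<open>The rotation will be \<open>A\<close>, then \<open>B\<close>, then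
      \<open>A\<close> again: \<open>A\<close> shifts \<open>t\<close> by
      \<open>- tan (\<phi> / 2) * s\<close> and \<open>B\<close> shifts \<open>s\<close> by
      \<open>sin \<phi> * t\<close>. Here \<open>q\<close> is the pair \<open>(w, s)\<close>, whose
      entry \<open>w\<close> stays fixed.\<close>
    define A :: "real \<times> real \<times> real \<Rightarrow> _" where "A = (\<lambda>(t, q). (t + (- tan (\<phi> / 2) * snd q), q))"
    define B :: "real \<times> real \<times> real \<Rightarrow> _" where "B = (\<lambda>(t, q). (t, q + (0, sin \<phi> * t)))"
    have [measurable]: "A \<in> borel \<rightarrow>\<^sub>M borel" "B \<in> borel \<rightarrow>\<^sub>M borel"
      unfolding A_def B_def split_beta' by (intro borel_measurable_continuous_onI continuous_intros)+
    have A: "distr lborel lborel A = lborel"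
      unfolding A_def
      by (rule distr_lborel_shear_fst) (intro borel_measurable_continuous_onI continuous_intros)
    have B: "distr lborel lborel B = lborel"
      unfolding B_def
      by (rule distr_lborel_apsnd)
        (auto simp: distr_lborel_translate borel_prod split_beta'
          intro!: borel_measurable_continuous_onI continuous_intros)
    have s: "sin \<phi> = 2 * sin (\<phi> / 2) * cos (\<phi> / 2)" "cos \<phi> = 1 - 2 * (sin (\<phi> / 2))\<^sup>2"
      using sin_double[of "\<phi> / 2"] cos_double_sin[of "\<phi> / 2"] by simp_all
    have 1: "1 - tan (\<phi> / 2) * sin \<phi> = cos \<phi>"
      unfolding s tan_def using c by (simp add: power2_eq_square)
    have 2: "tan (\<phi> / 2) * (1 + cos \<phi>) = sin \<phi>"
      using c cos_double_cos[of "\<phi> / 2"] unfolding s(1) tan_def by (simp add: power2_eq_square)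
    have "rot \<phi> q = A (B (A q))" for q
    proof -
      obtain t w s where q: "q = (t, w, s)" by (cases q) auto
      have "t + - tan (\<phi> / 2) * s + - tan (\<phi> / 2) * (s + sin \<phi> * (t + - tan (\<phi> / 2) * s)) =
          t * (1 - tan (\<phi> / 2) * sin \<phi>) - s * (tan (\<phi> / 2) * (1 + (1 - tan (\<phi> / 2) * sin \<phi>)))"
        by (simp add: algebra_simps)
      moreover have "s + sin \<phi> * (t + - tan (\<phi> / 2) * s) = t * sin \<phi> + s * (1 - tan (\<phi> / 2) * sin \<phi>)"
        by (simp add: algebra_simps)
      ultimately show ?thesis
        unfolding 1 2 by (simp add: q rot_def A_def B_def)
    qed
    then have "rot \<phi> = (\<lambda>q. A (B (A q)))" by blast
    moreover have "distr lborel lborel (\<lambda>q. A (B (A q))) = lborel"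
      by (intro distr_lborel_comp[of A "\<lambda>q. A (B q)"] distr_lborel_comp[of B A] A B) simp_all
    ultimately show ?thesis by simp
  qed
  show ?thesis
  proof (cases "cos (\<phi> / 2) = 0")
    case True
    \<comment> \<open>The double angle formula gives \<open>cos (\<phi> / 2) = -1\<close> wherever
      the cosine of the halved angle vanishes.\<close>
    then have "cos (\<phi> / 2 / 2) \<noteq> 0"
      using cos_double_cos[of "\<phi> / 2 / 2"] by auto
    from shears[OF this] have h: "distr lborel lborel (rot (\<phi> / 2)) = lborel" .
    have "rot \<phi> = (\<lambda>q. rot (\<phi> / 2) (rot (\<phi> / 2) q))"
      using rot_add[of "\<phi> / 2" "\<phi> / 2"] by auto
    then show ?thesis
      using distr_lborel_comp[of "rot (\<phi> / 2)" "rot (\<phi> / 2)"] h by simp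
  qed (rule shears)
qed

text \<open>At height \<open>w\<close>, the point with parameter \<open>s\<close> on the line with
  normal angle \<open>\<phi>\<close> and offset \<open>t\<close> that \<open>radon\<close>
  integrates over, written in the coordinate order of \<open>cylinder\<close>.\<close>

definition radon_coords :: "real \<Rightarrow> real \<times> real \<times> real \<Rightarrow> real \<times> real \<times> real" where
  "radon_coords \<phi> = (\<lambda>(t, w, s). (t * cos \<phi> - s * sin \<phi>, t * sin \<phi> + s * cos \<phi>, w))"

lemma radon_coords_measurable: "radon_coords \<phi> \<in> lborel \<rightarrow>\<^sub>M lborel"
  unfolding radon_coords_def split_beta'
  by (simp, intro borel_measurable_continuous_onI continuous_intros)

text \<open>The map is \<open>rot\<close> followed by the exchange of the last two
  coordinates.\<close>

lemma distr_lborel_radon_coords: "distr lborel lborel (radon_coords \<phi>) = lborel"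
proof -
  let ?T = "\<lambda>(t, q). (t :: real, (\<lambda>(w, s). (s :: real, w :: real)) q)"
  have m: "?T \<in> borel \<rightarrow>\<^sub>M borel"
    unfolding split_beta' by (intro borel_measurable_continuous_onI continuous_intros)
  have "distr lborel lborel ?T = lborel"
  proof (rule distr_lborel_apsnd)
    show "(\<lambda>(x :: real, q). (\<lambda>(w :: real, s :: real). (s, w)) q) \<in> borel \<Otimes>\<^sub>M borel \<rightarrow>\<^sub>M borel"
      unfolding split_beta' borel_prod by (intro borel_measurable_continuous_onI continuous_intros)
  qed (rule distr_lborel_swap)
  then have "distr lborel lborel (\<lambda>q. ?T (rot \<phi> q)) = lborel"
    using m by (intro distr_lborel_comp[of "rot \<phi>" ?T] distr_lborel_rot) simp_all
  moreover have "(\<lambda>q. ?T (rot \<phi> q)) = radon_coords \<phi>"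
    by (auto simp: rot_def radon_coords_def)
  ultimately show ?thesis by simp
qed

section \<open>Pairing with continuous kernels\<close>

lemma compact_cylinder: "compact (cylinder L)"
proof -
  have "closed {q :: real \<times> real \<times> real. (fst q)\<^sup>2 + (fst (snd q))\<^sup>2 \<le> 1 \<and> 0 \<le> snd (snd q) \<and> snd (snd q) \<le> L}"
    by (intro closed_Collect_conj closed_Collect_le continuous_intros)
  also have "\<dots> = cylinder L"
    by (auto simp: cylinder_def)
  finally have "closed (cylinder L)" .
  moreover have "cylinder L \<subseteq> {-1..1} \<times> {-1..1} \<times> {0..L}"
  proof -
    have "\<bar>x\<bar> \<le> 1 \<and> \<bar>y\<bar> \<le> 1" if "x\<^sup>2 + y\<^sup>2 \<le> 1" for x y :: real
    proof -
      have "x\<^sup>2 \<le> 1" "y\<^sup>2 \<le> 1"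
        using that zero_le_power2[of x] zero_le_power2[of y] by linarith+
      then show ?thesis by (simp add: abs_square_le_1)
    qed
    then show ?thesis by (fastforce simp: cylinder_def dest: abs_le_D1 abs_le_D2)
  qed
  moreover have "compact ({-1..1::real} \<times> {-1..1::real} \<times> {0..L})"
    by (intro compact_Times compact_Icc)
  ultimately show ?thesis
    using compact_Int_closed[of "{-1..1} \<times> {-1..1} \<times> {0..L}" "cylinder L"] by (simp add: Int_absorb1)
qed

lemma cylinder_borel [measurable]: "cylinder L \<in> sets borel"
  by (rule borel_compact[OF compact_cylinder])

text \<open>On the box \<open>[-1, 1] \<times> [-1, 1] \<times> [0, L]\<close> around the cylinder
  the integrand is a product of integrable functions of one variable.\<close>

lemma set_integrable_weight_cylinder:
  assumes "is_weight L W"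
  shows "set_integrable lebesgue (cylinder L) (\<lambda>q. W (snd (snd q)))"
proof -
  have "set_integrable lebesgue {0..L} (\<lambda>z. z ^ 0 * W z)"
    using assms unfolding is_weight_def by blast
  then have W: "integrable lebesgue (\<lambda>z. indicator {0..L} z * W z)"
    by (simp add: set_integrable_def)
  \<comment> \<open>A Borel version of the weight extended by zero, since the products are formed
    over \<open>lborel\<close>.\<close>
  obtain V where V: "V \<in> borel_measurable lborel" "AE z in lborel. indicator {0..L} z * W z = V z"
    using completion_ex_borel_measurable_real[OF borel_measurable_integrable[OF W]] by blast
  have Vi: "integrable lborel V"
    using W integrable_completion_AE_eq[OF V] by simp
  let ?I = "indicator {-1..1} :: real \<Rightarrow> real"
  let ?g = "\<lambda>(x, q). ?I x * (\<lambda>(y, z). ?I y * V z) q"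
  have I: "integrable lborel ?I" by simp
  have "integrable lborel ?g"
    by (intro integrable_lborel_product I Vi)
  then have gi: "integrable lborel (\<lambda>q. indicator (cylinder L) q *\<^sub>R ?g q)"
    by (intro integrable_mult_indicator) simp
  have "AE q in (lborel :: (real \<times> real \<times> real) measure). indicator {0..L} (snd (snd q)) * W (snd (snd q)) = V (snd (snd q))"
    by (rule AE_lborel_sndI[OF AE_lborel_sndI[OF V(2)]])
  then have ae: "AE q in lborel. indicator (cylinder L) q *\<^sub>R W (snd (snd q)) = indicator (cylinder L) q *\<^sub>R ?g q"
  proof eventually_elim
    fix q :: "real \<times> real \<times> real"
    assume *: "indicator {0..L} (snd (snd q)) * W (snd (snd q)) = V (snd (snd q))"
    obtain x y z where q: "q = (x, y, z)" by (cases q) auto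
    show "indicator (cylinder L) q *\<^sub>R W (snd (snd q)) = indicator (cylinder L) q *\<^sub>R ?g q"
    proof (cases "q \<in> cylinder L")
      case True
      then have "x\<^sup>2 + y\<^sup>2 \<le> 1" and z: "z \<in> {0..L}" by (auto simp: q cylinder_def)
      then have "x\<^sup>2 \<le> 1" "y\<^sup>2 \<le> 1"
        using zero_le_power2[of x] zero_le_power2[of y] by linarith+
      with z have "x \<in> {-1..1}" "y \<in> {-1..1}" "z \<in> {0..L}"
        by (auto simp: abs_square_le_1 abs_le_iff)
      then show ?thesis using * by (simp add: q)
    qed simp
  qed
  show ?thesis
    unfolding set_integrable_def
    using gi integrable_completion_AE_eq[OF borel_measurable_integrable[OF gi] ae] by blast
qed

text \<open>The weight has finite mass on the cylinder, so square integrability implies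
  integrability, and \<open>K\<close> is bounded on the compact cylinder. The majorant is
  \<open>B * (f\<^sup>2 + 1) * W\<close>.\<close>

lemma set_integrable_L2_mult_continuous:
  assumes W: "is_weight L W" and f: "f \<in> L2_cyl L W" and K: "continuous_on UNIV K"
  shows "set_integrable lebesgue (cylinder L) (\<lambda>q. f q * K q * W (snd (snd q)))"
proof -
  let ?C = "cylinder L" and ?W = "\<lambda>q :: real \<times> real \<times> real. W (snd (snd q))"
  have C[measurable]: "?C \<in> sets lebesgue" by simp
  have W0: "0 \<le> ?W q" if "q \<in> ?C" for q
    using W that by (auto simp: is_weight_def cylinder_def)
  have Wi: "integrable lebesgue (\<lambda>q. indicator ?C q * ?W q)"
    using set_integrable_weight_cylinder[OF W] by (simp add: set_integrable_def)
  have f2: "integrable lebesgue (\<lambda>q. indicator ?C q * ((f q)\<^sup>2 * ?W q))"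
    using f by (simp add: L2_cyl_def set_integrable_def)
  \<comment> \<open>Membership in \<open>L2_cyl\<close> gives measurability on the cylinder only,
    hence the extension by zero.\<close>
  have fm[measurable]: "(\<lambda>q. if q \<in> ?C then f q else 0) \<in> borel_measurable lebesgue"
    using f by (simp add: L2_cyl_def borel_measurable_if)
  have Km[measurable]: "K \<in> borel_measurable lebesgue"
    using borel_measurable_continuous_onI[OF K] by (intro measurable_completion) simp
  have Wm[measurable]: "(\<lambda>q. indicator ?C q * ?W q) \<in> borel_measurable lebesgue"
    by (rule borel_measurable_integrable[OF Wi])
  have "bounded (K ` ?C)"
    by (intro compact_imp_bounded compact_continuous_image compact_cylinder continuous_on_subset[OF K]) simp
  then obtain B where B: "\<And>q. q \<in> ?C \<Longrightarrow> \<bar>K q\<bar> \<le> B"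
    by (auto simp: bounded_iff)
  have "integrable lebesgue (\<lambda>q. (if q \<in> ?C then f q else 0) * K q * (indicator ?C q * ?W q))"
  proof (rule Bochner_Integration.integrable_bound)
    show "integrable lebesgue (\<lambda>q. B * (indicator ?C q * ((f q)\<^sup>2 * ?W q) + indicator ?C q * ?W q))"
      by (intro integrable_mult_right) (rule Bochner_Integration.integrable_add[OF f2 Wi])
    show "(\<lambda>q. (if q \<in> ?C then f q else 0) * K q * (indicator ?C q * ?W q)) \<in> borel_measurable lebesgue"
      by measurable
    show "AE q in lebesgue. norm ((if q \<in> ?C then f q else 0) * K q * (indicator ?C q * ?W q)) \<le>
        norm (B * (indicator ?C q * ((f q)\<^sup>2 * ?W q) + indicator ?C q * ?W q))"
    proof (intro AE_I2)
      fix q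
      show "norm ((if q \<in> ?C then f q else 0) * K q * (indicator ?C q * ?W q)) \<le>
        norm (B * (indicator ?C q * ((f q)\<^sup>2 * ?W q) + indicator ?C q * ?W q))"
      proof (cases "q \<in> ?C")
        case True
        have "\<bar>f q\<bar> \<le> (f q)\<^sup>2 + 1"
          using zero_le_power2[of "\<bar>f q\<bar> - 1"] unfolding power2_diff by simp
        then have "\<bar>f q\<bar> * \<bar>K q\<bar> * ?W q \<le> ((f q)\<^sup>2 + 1) * B * ?W q"
          using B[OF True] W0[OF True] by (intro mult_right_mono mult_mono) auto
        also have "\<dots> \<le> \<bar>((f q)\<^sup>2 + 1) * B * ?W q\<bar>" by simp
        finally show ?thesis
          using True W0[OF True] by (simp add: abs_mult algebra_simps)
      qed simp
    qed
  qed
  then show ?thesis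
    unfolding set_integrable_def
    by (rule back_subst[of "integrable lebesgue"]) (auto simp: indicator_def)
qed

lemma cyl_inner_sum:
  assumes "is_weight L W" "f \<in> L2_cyl L W" "\<And>i. i \<in> I \<Longrightarrow> continuous_on UNIV (K i)"
  shows "cyl_inner L W f (\<lambda>q. \<Sum>i\<in>I. K i q) = (\<Sum>i\<in>I. cyl_inner L W f (K i))"
proof -
  have "(LINT q:cylinder L|lebesgue. f q * (\<Sum>i\<in>I. K i q) * W (snd (snd q))) =
      (LINT q|lebesgue. (\<Sum>i\<in>I. indicator (cylinder L) q *\<^sub>R (f q * K i q * W (snd (snd q)))))"
    unfolding set_lebesgue_integral_def
    by (simp add: sum_distrib_left sum_distrib_right)
  also have "\<dots> = (\<Sum>i\<in>I. (LINT q:cylinder L|lebesgue. f q * K i q * W (snd (snd q))))"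
    unfolding set_lebesgue_integral_def
    by (rule Bochner_Integration.integral_sum)
      (rule set_integrable_L2_mult_continuous[OF assms(1,2) assms(3), unfolded set_integrable_def])
  finally show ?thesis
    unfolding cyl_inner_def by (simp add: sum_distrib_left)
qed

lemma cyl_inner_scale: "cyl_inner L W f (\<lambda>q. c * K q) = c * cyl_inner L W f K"
proof -
  have "(LINT q:cylinder L|lebesgue. f q * (c * K q) * W (snd (snd q))) =
      (LINT q:cylinder L|lebesgue. c * (f q * K q * W (snd (snd q))))"
    by (simp add: mult_ac)
  then show ?thesis
    unfolding cyl_inner_def by simp
qed

section \<open>Fubini in Radon coordinates\<close>

lemma unit_disc_slice_iff:
  "t\<^sup>2 + s\<^sup>2 \<le> 1 \<longleftrightarrow> t \<in> {-1..1} \<and> s \<in> {- sqrt (1 - t\<^sup>2)..sqrt (1 - t\<^sup>2)}" for t s :: real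
proof (cases "t \<in> {-1..1}")
  case True
  then have "0 \<le> 1 - t\<^sup>2" by (simp add: abs_square_le_1 abs_le_iff)
  then have "s\<^sup>2 \<le> 1 - t\<^sup>2 \<longleftrightarrow> \<bar>s\<bar> \<le> sqrt (1 - t\<^sup>2)"
    by (metis abs_ge_zero power2_abs real_sqrt_abs real_sqrt_le_iff)
  then show ?thesis using True by (auto simp: abs_le_iff)
next
  case False
  then have "\<not> t\<^sup>2 \<le> 1" by (auto simp: abs_square_le_1 abs_le_iff)
  then have "\<not> t\<^sup>2 + s\<^sup>2 \<le> 1" using zero_le_power2[of s] by linarith
  then show ?thesis using False by blast
qed

text \<open>Rotations preserve \<open>t\<^sup>2 + s\<^sup>2\<close>, and the disc is the union of
  its chords. This yields the integration limits of the iterated integral.\<close>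

lemma radon_coords_in_cylinder_iff:
  "radon_coords \<phi> (t, w, s) \<in> cylinder L \<longleftrightarrow>
     t \<in> {-1..1} \<and> w \<in> {0..L} \<and> s \<in> {- sqrt (1 - t\<^sup>2)..sqrt (1 - t\<^sup>2)}"
proof -
  have "(t * cos \<phi> - s * sin \<phi>)\<^sup>2 + (t * sin \<phi> + s * cos \<phi>)\<^sup>2 =
      (t\<^sup>2 + s\<^sup>2) * ((sin \<phi>)\<^sup>2 + (cos \<phi>)\<^sup>2)"
    by (simp only: power2_eq_square algebra_simps)
  also have "\<dots> = t\<^sup>2 + s\<^sup>2" by simp
  finally show ?thesis
    using unit_disc_slice_iff[of t s] by (auto simp: radon_coords_def cylinder_def)
qed

text \<open>In Radon coordinates \<open>u * cos \<phi> + v * sin \<phi>\<close> is \<open>t\<close>,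
  so the kernel and the weight are constant along each line. The innermost integral then acts on
  \<open>f\<close> alone and is its Radon projection.\<close>

lemma cyl_inner_ridge:
  fixes k :: "real \<Rightarrow> real \<Rightarrow> real"
  assumes "is_weight L W" "f \<in> L2_cyl L W" and k: "continuous_on UNIV (\<lambda>(w, t). k w t)"
  shows "cyl_inner L W f (\<lambda>(u, v, w). k w (u * cos \<phi> + v * sin \<phi>)) =
    1 / pi * (LINT t:{-1..1}|lebesgue. (LINT w:{0..L}|lebesgue.
      radon \<phi> (\<lambda>(u, v). f (u, v, w)) t * k w t * W w))"
proof -
  define K where "K = (\<lambda>(u, v, w). k w (u * cos \<phi> + v * sin \<phi>))"
  define G where "G = (\<lambda>q. indicator (cylinder L) q * (f q * K q * W (snd (snd q))))"
  have "continuous_on UNIV (\<lambda>q. (\<lambda>(w, t). k w t) (snd (snd q), fst q * cos \<phi> + fst (snd q) * sin \<phi>))"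
    by (rule continuous_on_compose2[OF k]) (auto intro!: continuous_intros)
  then have K: "continuous_on UNIV K"
    by (simp add: K_def split_beta')
  have G: "integrable lebesgue G"
    using set_integrable_L2_mult_continuous[OF assms(1,2) K] by (simp add: G_def set_integrable_def)
  \<comment> \<open>The factors are nested so that \<open>k w t * W w\<close> stands outside the
    part depending on \<open>s\<close>.\<close>
  have G_coords: "G (radon_coords \<phi> (t, w, s)) =
      indicator {-1..1} t * (indicator {0..L} w * (k w t * W w *
        (indicator {- sqrt (1 - t\<^sup>2)..sqrt (1 - t\<^sup>2)} s * f (radon_coords \<phi> (t, w, s)))))" for t w s
  proof -
    have "(t * cos \<phi> - s * sin \<phi>) * cos \<phi> + (t * sin \<phi> + s * cos \<phi>) * sin \<phi> =
        t * ((sin \<phi>)\<^sup>2 + (cos \<phi>)\<^sup>2)"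
      by (simp only: power2_eq_square algebra_simps)
    also have "\<dots> = t" by simp
    finally have "K (radon_coords \<phi> (t, w, s)) = k w t"
      by (simp add: K_def radon_coords_def)
    moreover have "snd (snd (radon_coords \<phi> (t, w, s))) = w"
      by (simp add: radon_coords_def)
    ultimately show ?thesis
      using radon_coords_in_cylinder_iff[of \<phi> t w s L]
      by (simp add: G_def indicator_def)
  qed
  have "(LINT q:cylinder L|lebesgue. f q * K q * W (snd (snd q))) = integral\<^sup>L lebesgue G"
    by (simp add: set_lebesgue_integral_def G_def)
  also have "\<dots> = (LINT q|lebesgue. G (radon_coords \<phi> q))"
    by (rule integral_lebesgue_measure_preserving[OF radon_coords_measurable distr_lborel_radon_coords G, symmetric])
  also have "\<dots> = (LINT t|lebesgue. LINT w|lebesgue. LINT s|lebesgue. G (radon_coords \<phi> (t, w, s)))"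
    by (rule integral_lebesgue_iterated3[symmetric],
        rule integrable_lebesgue_measure_preserving[OF radon_coords_measurable distr_lborel_radon_coords G])
  also have "\<dots> = (LINT t:{-1..1}|lebesgue. LINT w:{0..L}|lebesgue.
      radon \<phi> (\<lambda>(u, v). f (u, v, w)) t * k w t * W w)"
    \<comment> \<open>Factors constant in \<open>s\<close> leave the integral even where the
      integrand is not integrable: both sides are then 0 by convention.\<close>
    unfolding G_coords integral_mult_right_zero set_lebesgue_integral_def radon_def
    by (simp add: radon_coords_def mult_ac)
  finally show ?thesis
    unfolding cyl_inner_def K_def by simp
qed

section \<open>Continuity of the kernels and assembly of the formula\<close>

lemma continuous_on_cyl_basis: "continuous_on UNIV (cyl_basis p l k j)"
  unfolding cyl_basis_def ridge_U_def split_beta' by (intro continuous_intros)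

lemma continuous_on_Phi: "continuous_on UNIV (\<lambda>(w, t). Phi p m \<nu> w t x y z)"
  unfolding Phi_def split_beta' by (intro continuous_intros)

lemma continuous_on_Phi_ridge:
  "continuous_on UNIV (\<lambda>(u, v, w). Phi p m \<nu> w (u * a + v * b) x y z)"
  unfolding Phi_def split_beta' by (intro continuous_intros)

theorem theorem3p8:
  fixes L :: real and W :: "real \<Rightarrow> real" and p :: "nat \<Rightarrow> real poly"
    and f :: "real \<times> real \<times> real \<Rightarrow> real" and m :: nat and x y z :: real
  assumes "L > 0"
    and "is_weight L W"
    and "orthonormal_polys L W p"
    and "f \<in> L2_cyl L W"
    and "(x, y, z) \<in> cylinder L"
  shows "partial_sum L W p (2 * m) f (x, y, z) =
    1 / real (2 * m + 1) *
      (\<Sum>\<nu>=0..2*m. 1 / pi *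
        (LINT t:{-1..1}|lebesgue. (LINT w:{0..L}|lebesgue.
           radon (view_angle m \<nu>) (\<lambda>(u, v). f (u, v, w)) t * Phi p m \<nu> w t x y z * W w)))"
proof -
  note lin = cyl_inner_sum[OF assms(2,4)]
  let ?b = "\<lambda>l k j q. cyl_basis p l k j (x, y, z) * cyl_basis p l k j q"
  let ?\<Phi> = "\<lambda>\<nu> (u, v, w). Phi p m \<nu> w (u * cos (view_angle m \<nu>) + v * sin (view_angle m \<nu>)) x y z"
  \<comment> \<open>At the fixed point \<open>(x, y, z)\<close> the basis values are scalars and can
    be moved into the pairing.\<close>
  have "partial_sum L W p (2 * m) f (x, y, z) =
      (\<Sum>l=0..2*m. \<Sum>k=0..l. \<Sum>j=0..k. cyl_inner L W f (?b l k j))"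
    unfolding partial_sum_def fourier_coeff_def cyl_inner_scale by (simp add: mult.commute)
  also have "\<dots> = cyl_inner L W f (\<lambda>q. \<Sum>l=0..2*m. \<Sum>k=0..l. \<Sum>j=0..k. ?b l k j q)"
    by (simp add: lin continuous_on_cyl_basis continuous_on_sum continuous_on_mult_left)
  \<comment> \<open>The kernels agree at every \<open>q\<close>, inside the cylinder or not, so they
    are equal as functions.\<close>
  also have "(\<lambda>q. \<Sum>l=0..2*m. \<Sum>k=0..l. \<Sum>j=0..k. ?b l k j q) =
      (\<lambda>q. 1 / real (2 * m + 1) * (\<Sum>\<nu>=0..2*m. ?\<Phi> \<nu> q))"
    using partial_sum_kernel_eq[where p = p and m = m and x = x and y = y and z = z]
    by (auto simp: mult.commute)
  also have "cyl_inner L W f \<dots> = 1 / real (2 * m + 1) * (\<Sum>\<nu>=0..2*m. cyl_inner L W f (?\<Phi> \<nu>))"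
    unfolding cyl_inner_scale by (subst lin) (auto intro: continuous_on_Phi_ridge)
  finally show ?thesis
    unfolding cyl_inner_ridge[OF assms(2,4) continuous_on_Phi] .
qed

end
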